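(* Let $A\in\mathbb{R}^{m\times m}$ be symmetric positive definite, $b\in\mathbb{R}^m$, $w^*$ the solution of $Aw=b$, $w^0\in\mathbb{R}^m$ with $w^0\neq w^*$, and $w^{-1}=w^0$. Consider the coordinate descent iterates with momentum $$w^{k+1}=w^k-\gamma_k\frac{A_{i_k:}w^k-b_{i_k}}{A_{i_ki_k}}e_{i_k}+\beta_k(w^k-w^{k-1}),\qquad k\ge 0,$$ where the indices $i_k\in\{1,\ldots,m\}$ are sampled i.i.d. with $\mathbb{P}[i_k=i]=A_{ii}/\mathrm{Trace}(A)$. Let $\epsilon>0$, and let $t\in\mathbb{N}$ denote the iteration counter. (1) If the momentum parameters are set to $$\gamma_k=\frac{\eta}{(k+1)(1-\eta)+1},\qquad\beta_k=1-\frac{2-\eta}{(k+1)(1-\eta)+1}\qquad\text{with }\eta=0.5,$$ then the iterates satisfy $$t\ge 4\,\frac{\mathrm{Trace}(A)}{\epsilon}\ \Longrightarrow\ \frac{\mathbb{E}\left[\|Aw^t-b\|^2\right]}{\|w^0-w^*\|_A^2}<\epsilon.$$ (2) Alternatively, if no momentum is used ($\gamma_k=1$ and $\beta_k=0$ for all $k$), then the iterates satisfy $$t\ge\frac{\mathrm{Trace}(A)}{\lambda_{\min}(A)}\log\left(\frac{\lambda_{\max}(A)}{\epsilon}\right)\ \Longrightarrow\ \frac{\mathbb{E}\left[\|Aw^t-b\|^2\right]}{\|w^0-w^*\|_A^2}<\epsilon.$$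
   Context: $\mathbb{N}$ is the set of nonnegative integers, $e_i$ is the $i$-th column of the $m\times m$ identity matrix, $A_{i:}$ is the $i$-th row of $A$, $A_{ii}$ its $i$-th diagonal entry, $b_i$ the $i$-th entry of $b$, $\|\cdot\|$ is the Euclidean norm, $\|x\|_A=\sqrt{\langle x,Ax\rangle}$, and $\lambda_{\min}(A),\lambda_{\max}(A)$ are the smallest and largest eigenvalues of $A$.
   Formalization: In (2) the case t = 0 with ε = λ_max(A) is excluded: there the threshold is 0 and the strict inequality fails, with equality, when w^0 − w^* is an eigenvector for λ_max(A) (e.g. m = 1, A = 1, b = 0, w^0 = 1, ε = 1). *)

theory Defs
  imports "HOL-Probability.Probability"
begin

definition sym_pos_def :: "real^'m^'m \<Rightarrow> bool" where
  "sym_pos_def A \<longleftrightarrow> transpose A = A \<and> (\<forall>x. x \<noteq> 0 \<longrightarrow> x \<bullet> (A *v x) > 0)"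

definition energy_norm :: "real^'m^'m \<Rightarrow> real^'m \<Rightarrow> real" where
  "energy_norm A x = sqrt (x \<bullet> (A *v x))"

definition eigenvalues :: "real^'m^'m \<Rightarrow> real set" where
  "eigenvalues A = {l. \<exists>v. v \<noteq> 0 \<and> A *v v = l *\<^sub>R v}"

(* Only meaningful when the set of real eigenvalues is nonempty (it is always finite),
   which is the case for symmetric A. *)
definition lambda_min :: "real^'m^'m \<Rightarrow> real" where
  "lambda_min A = Min (eigenvalues A)"

definition lambda_max :: "real^'m^'m \<Rightarrow> real" where
  "lambda_max A = Max (eigenvalues A)"

(* The iterates along one realization idx of the sampled coordinates.  At k = 0 the
   truncated subtraction gives w (0 - 1) = w 0, which is the convention w^(-1) = w^0. *)
fun cd_iterate ::
  "real^'m^'m \<Rightarrow> real^'m \<Rightarrow> (nat \<Rightarrow> real) \<Rightarrow> (nat \<Rightarrow> real) \<Rightarrow> real^'m \<Rightarrow> (nat \<Rightarrow> 'm) \<Rightarrow> nat \<Rightarrow> real^'m"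
where
  "cd_iterate A b \<gamma> \<beta> w0 idx 0 = w0"
| "cd_iterate A b \<gamma> \<beta> w0 idx (Suc k) =
     cd_iterate A b \<gamma> \<beta> w0 idx k
     - (\<gamma> k * ((row (idx k) A \<bullet> cd_iterate A b \<gamma> \<beta> w0 idx k - b $ idx k) / A $ idx k $ idx k))
         *\<^sub>R axis (idx k) 1
     + \<beta> k *\<^sub>R (cd_iterate A b \<gamma> \<beta> w0 idx k - cd_iterate A b \<gamma> \<beta> w0 idx (k - 1))"

definition gamma_momentum :: "real \<Rightarrow> nat \<Rightarrow> real" where
  "gamma_momentum \<eta> k = \<eta> / ((real k + 1) * (1 - \<eta>) + 1)"

definition beta_momentum :: "real \<Rightarrow> nat \<Rightarrow> real" where
  "beta_momentum \<eta> k = 1 - (2 - \<eta>) / ((real k + 1) * (1 - \<eta>) + 1)"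

end

theory Submission
  imports Defs
begin

text \<open>In the inner product induced by \<open>A\<close>, a coordinate step is a stochastic gradient step for
  \<open>f(w) = \<parallel>A w - b\<parallel>\<^sup>2 / (2 Trace A)\<close>, and a step of relative size \<open>s\<close> from \<open>z\<close> along the residual
  \<open>g\<close> changes the expected energy of \<open>z\<close> by \<open>- (2 s \<langle>g, A z\<rangle> - s\<^sup>2 \<parallel>g\<parallel>\<^sup>2) / Trace A\<close>.
  Without momentum (\<open>s = 1\<close>, \<open>z = w - w\<^sup>*\<close>) the energy contracts by \<open>1 - \<lambda>\<^sub>m\<^sub>i\<^sub>n / Trace A\<close>.
  With momentum, the extrapolated point \<open>z\<^sub>k\<close> performs steps with \<open>s = 1/2\<close>, and its energy plus
  \<open>k/4 \<parallel>A w\<^sub>k\<^sub>-\<^sub>1 - b\<parallel>\<^sup>2 / Trace A\<close> is a supermartingale, which yields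
  \<open>(t + 1) E\<parallel>A w\<^sub>t - b\<parallel>\<^sup>2 \<le> 4 Trace A \<parallel>w\<^sub>0 - w\<^sup>*\<parallel>\<^sub>A\<^sup>2\<close>.\<close>

section \<open>Extreme eigenvalues of a self-adjoint map\<close>

text \<open>Discriminant argument: the form evaluated at \<open>x + t *\<^sub>R y\<close> is a
  nonnegative polynomial in \<open>t\<close>. As \<open>f\<close> is only semidefinite, its leading
  coefficient \<open>c\<close> may vanish.\<close>

lemma psd_Cauchy_Schwarz:
  fixes f :: "'a::real_inner \<Rightarrow> 'a"
  assumes lin: "linear f" and sym: "\<And>x y. x \<bullet> f y = f x \<bullet> y" and psd: "\<And>x. 0 \<le> x \<bullet> f x"
  shows "(x \<bullet> f y)\<^sup>2 \<le> (x \<bullet> f x) * (y \<bullet> f y)"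
proof -
  define a b c where "a = x \<bullet> f x" and "b = x \<bullet> f y" and "c = y \<bullet> f y"
  have nonneg: "0 \<le> a + 2 * t * b + t\<^sup>2 * c" for t
  proof -
    have "y \<bullet> f x = b"
      by (metis b_def inner_commute sym)
    moreover have "(x + t *\<^sub>R y) \<bullet> f (x + t *\<^sub>R y)
        = x \<bullet> f x + t * (x \<bullet> f y) + t * (y \<bullet> f x) + t * t * (y \<bullet> f y)"
      by (simp add: linear_add[OF lin] linear_scale[OF lin] inner_add_left inner_add_right
          distrib_left)
    ultimately have "(x + t *\<^sub>R y) \<bullet> f (x + t *\<^sub>R y) = a + 2 * t * b + t\<^sup>2 * c"
      by (simp add: a_def[symmetric] b_def[symmetric] c_def[symmetric] power2_eq_square)
    then show ?thesis
      using psd by metis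
  qed
  have "c \<ge> 0"
    using psd c_def by simp
  have "b\<^sup>2 \<le> a * c"
  proof (cases "c = 0")
    case True
    have "b = 0"
    proof (rule ccontr)
      assume "b \<noteq> 0"
      then show False
        \<comment> \<open>With \<open>c = 0\<close> the polynomial is affine in \<open>t\<close>,
          and this \<open>t\<close> gives it the value -1.\<close>
        using nonneg[of "- (a + 1) / (2 * b)"] True by (simp add: field_simps)
    qed
    then show ?thesis
      using True by simp
  next
    case False
    with \<open>c \<ge> 0\<close> have "c > 0" by simp
    \<comment> \<open>\<open>- b / c\<close> is the minimiser of the quadratic in
      \<open>t\<close>.\<close>
    have "0 \<le> c * (a + 2 * (- b / c) * b + (- b / c)\<^sup>2 * c)"
      using \<open>c \<ge> 0\<close> nonneg by (rule mult_nonneg_nonneg)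
    also have "\<dots> = a * c - b\<^sup>2"
      using False by (simp add: field_simps power2_eq_square)
    finally show ?thesis by simp
  qed
  then show ?thesis
    by (simp add: a_def b_def c_def)
qed

text \<open>The form attains a maximum \<open>\<mu>\<close> on the compact unit sphere, at some
  \<open>v\<close>. Then \<open>\<mu>\<close> times the identity minus \<open>f\<close> is positive
  semidefinite with vanishing form at \<open>v\<close>, which forces it to annihilate
  \<open>v\<close>.\<close>

lemma rayleigh_max_eigenvector:
  fixes f :: "'a::euclidean_space \<Rightarrow> 'a"
  assumes lin: "linear f" and sym: "\<And>x y. x \<bullet> f y = f x \<bullet> y"
  obtains \<mu> v where "v \<noteq> 0" "f v = \<mu> *\<^sub>R v" "\<And>x. x \<bullet> f x \<le> \<mu> * (x \<bullet> x)"
proof -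
  have "continuous_on (sphere 0 1) f"
    using lin by (simp add: linear_continuous_on linear_conv_bounded_linear)
  then have cont: "continuous_on (sphere 0 1) (\<lambda>x. x \<bullet> f x)"
    by (intro continuous_intros)
  have ne: "sphere (0::'a) 1 \<noteq> {}"
    by simp
  obtain v where v: "v \<in> sphere 0 1" and max: "\<forall>x\<in>sphere 0 1. x \<bullet> f x \<le> v \<bullet> f v"
    using continuous_attains_sup[OF compact_sphere ne cont] by blast
  define \<mu> where "\<mu> = v \<bullet> f v"
  have nv: "norm v = 1"
    using v by simp
  have bound: "x \<bullet> f x \<le> \<mu> * (x \<bullet> x)" for x
  proof (cases "x = 0")
    case False
    define u where "u = x /\<^sub>R norm x"
    have x: "x = norm x *\<^sub>R u"
      using False by (simp add: u_def)
    have "u \<bullet> f u \<le> \<mu>"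
      using bspec[OF max, of u] False by (simp add: u_def \<mu>_def)
    then have "(norm x)\<^sup>2 * (u \<bullet> f u) \<le> (norm x)\<^sup>2 * \<mu>"
      by (simp add: mult_left_mono)
    moreover have "x \<bullet> f x = (norm x)\<^sup>2 * (u \<bullet> f u)"
      by (subst (1 2) x) (simp add: linear_scale[OF lin] power2_eq_square)
    ultimately show ?thesis
      by (simp add: power2_norm_eq_inner mult.commute)
  qed simp
  define g where "g x = \<mu> *\<^sub>R x - f x" for x
  have lg: "linear g"
    unfolding g_def
    by (rule linearI) (simp_all add: linear_add[OF lin] linear_scale[OF lin] algebra_simps)
  have sg: "x \<bullet> g y = g x \<bullet> y" for x y
    using sym[of x y] by (simp add: g_def inner_simps)
  have pg: "0 \<le> x \<bullet> g x" for x
    using bound by (simp add: g_def inner_simps)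
  have "v \<bullet> g v = 0"
    using nv by (simp add: g_def inner_simps \<mu>_def dot_square_norm)
  then have "(g v \<bullet> g v)\<^sup>2 \<le> 0"
    using psd_Cauchy_Schwarz[OF lg sg pg, of "g v" v] by simp
  then have "f v = \<mu> *\<^sub>R v"
    by (simp add: g_def)
  moreover have "v \<noteq> 0"
    using nv by auto
  ultimately show thesis
    using that bound by blast
qed

lemma rayleigh_min_eigenvector:
  fixes f :: "'a::euclidean_space \<Rightarrow> 'a"
  assumes lin: "linear f" and sym: "\<And>x y. x \<bullet> f y = f x \<bullet> y"
  obtains \<mu> v where "v \<noteq> 0" "f v = \<mu> *\<^sub>R v" "\<And>x. \<mu> * (x \<bullet> x) \<le> x \<bullet> f x"
proof -
  have "linear (\<lambda>x. - f x)"
    using lin by (rule linear_compose_neg)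
  moreover have "x \<bullet> - f y = - f x \<bullet> y" for x y
    using sym[of x y] by simp
  ultimately obtain \<mu> v where *: "v \<noteq> 0" "- f v = \<mu> *\<^sub>R v" "\<And>x. x \<bullet> - f x \<le> \<mu> * (x \<bullet> x)"
    using rayleigh_max_eigenvector by metis
  show thesis
  proof (rule that[of v "- \<mu>"])
    show "f v = (- \<mu>) *\<^sub>R v"
      using *(2) by (metis minus_equation_iff scaleR_minus_left)
    show "- \<mu> * (x \<bullet> x) \<le> x \<bullet> f x" for x
      using *(3)[of x] by simp
  qed (rule *)
qed

section \<open>Spectral bounds for symmetric matrices\<close>

lemma symmetric_matrix_inner:
  fixes A :: "real^'m^'m"
  assumes "transpose A = A"
  shows "x \<bullet> (A *v y) = (A *v x) \<bullet> y"
  by (metis assms dot_lmul_matrix transpose_matrix_vector)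

text \<open>Choosing one eigenvector per eigenvalue gives an orthogonal, hence independent, family.
  Finiteness is what makes the \<open>Min\<close> and \<open>Max\<close> in
  \<open>lambda_min\<close> and \<open>lambda_max\<close> meaningful.\<close>

lemma finite_eigenvalues_symmetric:
  fixes A :: "real^'m^'m"
  assumes "transpose A = A"
  shows "finite (eigenvalues A)"
proof -
  define v where "v l = (SOME v. v \<noteq> 0 \<and> A *v v = l *\<^sub>R v)" for l
  have v: "v l \<noteq> 0" "A *v v l = l *\<^sub>R v l" if "l \<in> eigenvalues A" for l
    using someI_ex[of "\<lambda>v. v \<noteq> 0 \<and> A *v v = l *\<^sub>R v"] that
    by (auto simp: eigenvalues_def v_def)
  have orth: "orthogonal (v k) (v l)"
    if "k \<in> eigenvalues A" "l \<in> eigenvalues A" "k \<noteq> l" for k l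
  proof -
    have "l * (v k \<bullet> v l) = k * (v k \<bullet> v l)"
      using symmetric_matrix_inner[OF assms, of "v k" "v l"] v that by simp
    then show ?thesis
      using that by (simp add: orthogonal_def)
  qed
  have "inj_on v (eigenvalues A)"
    by (rule inj_onI) (metis orth orthogonal_self v(1))
  moreover have "independent (v ` eigenvalues A)"
  proof (rule pairwise_orthogonal_independent)
    show "pairwise orthogonal (v ` eigenvalues A)"
      by (auto simp: pairwise_def intro: orth)
  qed (use v in auto)
  ultimately show ?thesis
    using independent_imp_finite finite_imageD by blast
qed

lemma lambda_max_rayleigh:
  fixes A :: "real^'m^'m"
  assumes "transpose A = A"
  shows "x \<bullet> (A *v x) \<le> lambda_max A * (x \<bullet> x)"
proof -
  obtain \<mu> v where *: "v \<noteq> 0" "A *v v = \<mu> *\<^sub>R v" "\<And>x. x \<bullet> (A *v x) \<le> \<mu> * (x \<bullet> x)"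
    using rayleigh_max_eigenvector[OF matrix_vector_mul_linear symmetric_matrix_inner[OF assms]]
    by blast
  have "\<mu> \<in> eigenvalues A"
    using * by (auto simp: eigenvalues_def)
  then have "\<mu> \<le> lambda_max A"
    by (simp add: finite_eigenvalues_symmetric[OF assms] lambda_max_def)
  then have "\<mu> * (x \<bullet> x) \<le> lambda_max A * (x \<bullet> x)"
    by (simp add: mult_right_mono)
  then show ?thesis
    using *(3)[of x] by linarith
qed

lemma lambda_min_rayleigh:
  fixes A :: "real^'m^'m"
  assumes "transpose A = A"
  shows "lambda_min A * (x \<bullet> x) \<le> x \<bullet> (A *v x)"
proof -
  obtain \<mu> v where *: "v \<noteq> 0" "A *v v = \<mu> *\<^sub>R v" "\<And>x. \<mu> * (x \<bullet> x) \<le> x \<bullet> (A *v x)"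
    using rayleigh_min_eigenvector[OF matrix_vector_mul_linear symmetric_matrix_inner[OF assms]]
    by blast
  have "\<mu> \<in> eigenvalues A"
    using * by (auto simp: eigenvalues_def)
  then have "lambda_min A \<le> \<mu>"
    by (simp add: finite_eigenvalues_symmetric[OF assms] lambda_min_def)
  then have "lambda_min A * (x \<bullet> x) \<le> \<mu> * (x \<bullet> x)"
    by (simp add: mult_right_mono)
  then show ?thesis
    using *(3)[of x] by linarith
qed

lemma lambda_min_eigenvalue:
  fixes A :: "real^'m^'m"
  assumes "transpose A = A"
  shows "lambda_min A \<in> eigenvalues A"
proof -
  obtain \<mu> v where "v \<noteq> 0" "A *v v = \<mu> *\<^sub>R v"
    using rayleigh_min_eigenvector[OF matrix_vector_mul_linear symmetric_matrix_inner[OF assms]]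
    by blast
  then have "eigenvalues A \<noteq> {}"
    by (auto simp: eigenvalues_def)
  then show ?thesis
    by (simp add: finite_eigenvalues_symmetric[OF assms] lambda_min_def)
qed

section \<open>Symmetric positive definite matrices\<close>

context
  fixes A :: "real^'m^'m"
  assumes spd: "sym_pos_def A"
begin

lemma spd_sym: "transpose A = A"
  and spd_pos: "x \<noteq> 0 \<Longrightarrow> 0 < x \<bullet> (A *v x)"
  using spd by (auto simp: sym_pos_def_def)

lemma spd_nonneg: "0 \<le> x \<bullet> (A *v x)"
  using spd_pos[of x] by (cases "x = 0") auto

lemma energy_norm_sq: "(energy_norm A x)\<^sup>2 = x \<bullet> (A *v x)"
  by (simp add: energy_norm_def spd_nonneg)

lemma spd_diag_pos: "0 < A $ j $ j"
proof -
  have "axis j 1 \<bullet> (A *v axis j 1) = A $ j $ j"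
    by (simp add: inner_axis' matrix_vector_mult_basis column_def)
  moreover have "axis j (1::real) \<noteq> 0"
    by (simp add: axis_eq_0_iff)
  ultimately show ?thesis
    using spd_pos by metis
qed

lemma spd_trace_pos: "0 < trace A"
  unfolding trace_def by (rule sum_pos) (auto simp: spd_diag_pos)

lemma spd_lambda_min_pos: "0 < lambda_min A"
proof -
  obtain v where v: "v \<noteq> 0" "A *v v = lambda_min A *\<^sub>R v"
    using lambda_min_eigenvalue[OF spd_sym] by (auto simp: eigenvalues_def)
  then have "0 < lambda_min A * (v \<bullet> v)"
    using spd_pos[of v] by simp
  then show ?thesis
    by (rule zero_less_mult_pos2) (simp add: v(1))
qed

lemma spd_lambda_max_pos: "0 < lambda_max A"
proof -
  let ?v = "axis undefined 1 :: real^'m"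
  have "?v \<noteq> 0"
    by (simp add: axis_eq_0_iff)
  then have "0 < lambda_max A * (?v \<bullet> ?v)"
    using spd_pos[of ?v] lambda_max_rayleigh[OF spd_sym, of ?v] by linarith
  then show ?thesis
    by (simp add: inner_axis_axis)
qed

text \<open>Cauchy-Schwarz in the inner product of \<open>A\<close>, applied to \<open>x\<close> and
  \<open>A *v x\<close>, followed by the Rayleigh bound at \<open>A *v x\<close>; one factor of the
  squared residual cancels. It turns an energy bound into a residual bound.\<close>

lemma spd_residual_upper: "(norm (A *v x))\<^sup>2 \<le> lambda_max A * (x \<bullet> (A *v x))"
proof -
  let ?y = "A *v x"
  let ?n = "?y \<bullet> ?y"
  have "?n\<^sup>2 = (x \<bullet> (A *v ?y))\<^sup>2"
    using symmetric_matrix_inner[OF spd_sym, of x ?y] by simp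
  also have "\<dots> \<le> (x \<bullet> ?y) * (?y \<bullet> (A *v ?y))"
    by (rule psd_Cauchy_Schwarz[OF matrix_vector_mul_linear
          symmetric_matrix_inner[OF spd_sym] spd_nonneg])
  also have "\<dots> \<le> (x \<bullet> ?y) * (lambda_max A * ?n)"
    by (intro mult_left_mono lambda_max_rayleigh[OF spd_sym] spd_nonneg)
  finally have "?n * ?n \<le> (lambda_max A * (x \<bullet> ?y)) * ?n"
    by (simp add: power2_eq_square algebra_simps)
  then show ?thesis
    using spd_lambda_max_pos spd_nonneg[of x]
    by (cases "?y = 0") (auto simp: power2_norm_eq_inner)
qed

text \<open>Euclidean Cauchy-Schwarz for \<open>x\<close> and \<open>A *v x\<close>, combined with
  the Rayleigh lower bound at \<open>x\<close>. This gives the contraction of the energy without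
  momentum.\<close>

lemma spd_residual_lower: "lambda_min A * (x \<bullet> (A *v x)) \<le> (norm (A *v x))\<^sup>2"
proof (cases "x = 0")
  case False
  let ?q = "x \<bullet> (A *v x)" and ?N = "(norm (A *v x))\<^sup>2"
  have "?q\<^sup>2 \<le> (x \<bullet> x) * ?N"
    using Cauchy_Schwarz_ineq[of x "A *v x"] by (simp add: power2_norm_eq_inner)
  then have "lambda_min A * ?q\<^sup>2 \<le> lambda_min A * ((x \<bullet> x) * ?N)"
    using spd_lambda_min_pos by (intro mult_left_mono) auto
  also have "\<dots> \<le> ?q * ?N"
    unfolding mult.assoc[symmetric]
    by (intro mult_right_mono lambda_min_rayleigh[OF spd_sym]) auto
  finally have "?q * (lambda_min A * ?q) \<le> ?q * ?N"
    by (simp add: power2_eq_square algebra_simps)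
  then show ?thesis
    using spd_pos[OF False] by (simp add: mult_le_cancel_left_pos)
qed simp

text \<open>A diagonal entry is a Rayleigh quotient, and the other diagonal entries are positive.
  Hence the contraction factor \<open>1 - lambda_min A / trace A\<close> is nonnegative.\<close>

lemma spd_lambda_min_le_trace: "lambda_min A \<le> trace A"
proof -
  let ?e = "axis undefined 1 :: real^'m"
  have "lambda_min A \<le> A $ undefined $ undefined"
    using lambda_min_rayleigh[OF spd_sym, of ?e]
    by (simp add: inner_axis' matrix_vector_mult_basis column_def)
  also have "\<dots> \<le> trace A"
    unfolding trace_def
    by (rule member_le_sum) (auto intro: less_imp_le spd_diag_pos)
  finally show ?thesis .
qed

text \<open>The sampling weights proportional to \<open>A $ j $ j\<close> cancel the denominators of
  the coordinate step, so the sums over \<open>j\<close> become inner products. \<open>g\<close> is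
  independent of \<open>z\<close> because with momentum the residual is taken at a point other than
  the one being moved.\<close>

lemma expected_coordinate_step:
  "(\<Sum>j\<in>UNIV. A $ j $ j / trace A *
      ((z - (s * g $ j / A $ j $ j) *\<^sub>R axis j 1) \<bullet> (A *v (z - (s * g $ j / A $ j $ j) *\<^sub>R axis j 1))))
    = z \<bullet> (A *v z) - (2 * s * (g \<bullet> (A *v z)) - s\<^sup>2 * (g \<bullet> g)) / trace A"
proof -
  have step: "A $ j $ j / trace A *
      ((z - (s * g $ j / A $ j $ j) *\<^sub>R axis j 1) \<bullet> (A *v (z - (s * g $ j / A $ j $ j) *\<^sub>R axis j 1)))
    = A $ j $ j * ((z \<bullet> (A *v z)) / trace A)
      - (2 * s / trace A) * (g $ j * (A *v z) $ j) + (s\<^sup>2 / trace A) * (g $ j * g $ j)" for j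
  proof -
    have 1: "z \<bullet> (A *v axis j 1) = (A *v z) $ j"
      using symmetric_matrix_inner[OF spd_sym, of z "axis j 1"] by (simp add: inner_axis)
    have 2: "axis j 1 \<bullet> (A *v z) = (A *v z) $ j"
      by (simp add: inner_axis')
    have 3: "axis j 1 \<bullet> (A *v axis j 1) = A $ j $ j"
      by (simp add: inner_axis' matrix_vector_mult_basis column_def)
    have "(z - c *\<^sub>R axis j 1) \<bullet> (A *v (z - c *\<^sub>R axis j 1))
        = z \<bullet> (A *v z) - 2 * c * (A *v z) $ j + c\<^sup>2 * A $ j $ j" for c
      by (simp add: matrix_vector_mult_diff_distrib matrix_vector_mult_scaleR inner_diff_left
          inner_diff_right 1 2 3 power2_eq_square algebra_simps del: matrix_vector_mult_basis)
    from this[of "s * g $ j / A $ j $ j"] show ?thesis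
      using spd_diag_pos[of j] spd_trace_pos
      by (simp only:) (simp add: field_simps power2_eq_square)
  qed
  have "(\<Sum>j\<in>UNIV. A $ j $ j * ((z \<bullet> (A *v z)) / trace A)) = z \<bullet> (A *v z)"
    unfolding sum_distrib_right[symmetric] using spd_trace_pos by (simp add: trace_def)
  then show ?thesis
    unfolding step sum.distrib sum_subtractf sum_distrib_left[symmetric]
    by (simp add: inner_vec_def diff_divide_distrib)
qed

end

section \<open>Expectations over independent finite samples\<close>

context prob_space
begin

context
  fixes i :: "nat \<Rightarrow> 'a \<Rightarrow> 'm::finite"
  assumes indep: "indep_vars (\<lambda>_. count_space UNIV) i UNIV"
begin

lemma measurable_prefix:
  "(\<lambda>\<omega>. restrict (\<lambda>n. i n \<omega>) {..<k}) \<in> measurable M (count_space ({..<k} \<rightarrow>\<^sub>E UNIV))"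
proof -
  have "(\<lambda>\<omega>. restrict (\<lambda>n. i n \<omega>) {..<k}) \<in> measurable M (PiM {..<k} (\<lambda>_. count_space UNIV))"
    using indep by (intro measurable_restrict) (auto simp: indep_vars_def)
  then show ?thesis
    by (simp add: count_space_PiM_finite)
qed

text \<open>A function of the first \<open>k\<close> samples takes finitely many values and is
  measurable on the finite space of prefixes.\<close>

lemma integrable_prefix:
  fixes G :: "(nat \<Rightarrow> 'm) \<Rightarrow> real"
  assumes dep: "\<And>x y. (\<forall>n<k. x n = y n) \<Longrightarrow> G x = G y"
  shows "integrable M (\<lambda>\<omega>. G (\<lambda>n. i n \<omega>))"
proof -
  let ?P = "{..<k} \<rightarrow>\<^sub>E (UNIV :: 'm set)"
  have eq: "G (\<lambda>n. i n \<omega>) = G (restrict (\<lambda>n. i n \<omega>) {..<k})" for \<omega>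
    by (rule dep) simp
  have fin: "finite (G ` ?P)"
    by (intro finite_imageI finite_PiE) auto
  have "norm (G (\<lambda>n. i n \<omega>)) \<le> Max (norm ` G ` ?P)" for \<omega>
    unfolding eq by (intro Max_ge finite_imageI[OF fin] imageI) (simp add: PiE_def extensional_def)
  moreover have "(\<lambda>\<omega>. G (\<lambda>n. i n \<omega>)) \<in> borel_measurable M"
    unfolding eq by (rule measurable_compose[OF measurable_prefix]) simp
  ultimately show ?thesis
    by (intro integrable_const_bound) auto
qed

text \<open>Conditioning on the first \<open>k\<close> samples, done by hand: split according to the
  value \<open>j\<close> of sample \<open>k\<close>. Once that slot is overwritten by
  \<open>j\<close>, \<open>G\<close> depends on earlier samples only, so it is independent of the
  indicator and the expectation factorises.\<close>

lemma expectation_next_sample: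
  fixes G :: "(nat \<Rightarrow> 'm) \<Rightarrow> real"
  assumes dep: "\<And>x y. (\<forall>n<Suc k. x n = y n) \<Longrightarrow> G x = G y"
  shows "expectation (\<lambda>\<omega>. G (\<lambda>n. i n \<omega>))
    = expectation (\<lambda>\<omega>. \<Sum>j\<in>UNIV. prob {\<omega> \<in> space M. i k \<omega> = j} * G ((\<lambda>n. i n \<omega>)(k := j)))"
proof -
  let ?X = "\<lambda>\<omega> n. i n \<omega>"
  let ?I = "\<lambda>j \<omega>. indicator {j} (i k \<omega>) :: real"
  have rv: "i k \<in> measurable M (count_space UNIV)"
    using indep by (auto simp: indep_vars_def)
  have intG: "integrable M (\<lambda>\<omega>. G ((?X \<omega>)(k := j)))" for j
    by (rule integrable_prefix[where k = k and G = "\<lambda>x. G (x(k := j))"])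
       (auto intro!: dep simp: less_Suc_eq)
  have intI: "integrable M (?I j)" for j
    by (rule integrable_const_bound[where B = 1])
       (auto intro!: measurable_compose[OF rv] simp: indicator_def)
  have EI: "expectation (?I j) = prob {\<omega> \<in> space M. i k \<omega> = j}" for j
  proof -
    have "expectation (?I j) = expectation (indicator {\<omega> \<in> space M. i k \<omega> = j})"
      by (rule Bochner_Integration.integral_cong) (auto simp: indicator_def)
    moreover have "{\<omega> \<in> space M. i k \<omega> = j} \<inter> space M = {\<omega> \<in> space M. i k \<omega> = j}"
      by auto
    ultimately show ?thesis
      by simp
  qed
  have ind: "indep_var borel (?I j) borel (\<lambda>\<omega>. G ((?X \<omega>)(k := j)))" for j
  proof -
    have "indep_var borel ((\<lambda>f. indicator {j} (f k)) \<circ> (\<lambda>\<omega>. restrict (?X \<omega>) {k}))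
        borel ((\<lambda>x. G (x(k := j))) \<circ> (\<lambda>\<omega>. restrict (?X \<omega>) {..<k}))"
      by (rule indep_var_compose[OF indep_var_restrict[OF indep]])
         (auto simp: count_space_PiM_finite)
    moreover have "G ((restrict (?X \<omega>) {..<k})(k := j)) = G ((?X \<omega>)(k := j))" for \<omega>
      by (rule dep) (auto simp: less_Suc_eq)
    ultimately show ?thesis
      by (simp add: comp_def)
  qed
  have "expectation (\<lambda>\<omega>. G (?X \<omega>)) = expectation (\<lambda>\<omega>. \<Sum>j\<in>UNIV. ?I j \<omega> * G ((?X \<omega>)(k := j)))"
  proof (rule Bochner_Integration.integral_cong[OF refl])
    fix \<omega>
    have "(\<Sum>j\<in>UNIV. ?I j \<omega> * G ((?X \<omega>)(k := j))) = (\<Sum>j\<in>{i k \<omega>}. G ((?X \<omega>)(k := j)))"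
      by (rule sum.mono_neutral_cong_right) (auto simp: indicator_def)
    moreover have "(?X \<omega>)(k := i k \<omega>) = ?X \<omega>"
      by auto
    ultimately show "G (?X \<omega>) = (\<Sum>j\<in>UNIV. ?I j \<omega> * G ((?X \<omega>)(k := j)))"
      by simp
  qed
  also have "\<dots> = (\<Sum>j\<in>UNIV. expectation (\<lambda>\<omega>. ?I j \<omega> * G ((?X \<omega>)(k := j))))"
    by (rule Bochner_Integration.integral_sum) (rule indep_var_integrable[OF ind intI intG])
  also have "\<dots> = (\<Sum>j\<in>UNIV. prob {\<omega> \<in> space M. i k \<omega> = j} * expectation (\<lambda>\<omega>. G ((?X \<omega>)(k := j))))"
    unfolding indep_var_lebesgue_integral[OF ind intI intG] EI ..
  also have "\<dots> = expectation (\<lambda>\<omega>. \<Sum>j\<in>UNIV. prob {\<omega> \<in> space M. i k \<omega> = j} * G ((?X \<omega>)(k := j)))"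
    by (simp add: Bochner_Integration.integral_sum intG)
  finally show ?thesis .
qed

text \<open>Induction on \<open>t\<close>, averaging over one new sample at a time. The factor
  \<open>c\<close> is below 1 without momentum and equal to 1 (a supermartingale) with momentum;
  \<open>x0\<close> is arbitrary because \<open>V 0\<close> is constant.\<close>

lemma expectation_contraction:
  fixes V :: "nat \<Rightarrow> (nat \<Rightarrow> 'm) \<Rightarrow> real"
  assumes dep: "\<And>k x y. (\<forall>n<k. x n = y n) \<Longrightarrow> V k x = V k y"
    and dist: "\<And>k j. prob {\<omega> \<in> space M. i k \<omega> = j} = p j"
    and step: "\<And>k x. (\<Sum>j\<in>UNIV. p j * V (Suc k) (x(k := j))) \<le> c * V k x"
    and c: "0 \<le> c"
  shows "expectation (\<lambda>\<omega>. V t (\<lambda>n. i n \<omega>)) \<le> c ^ t * V 0 x0"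
proof (induction t)
  case 0
  have "V 0 x = V 0 x0" for x
    by (rule dep) simp
  then have "(\<lambda>\<omega>. V 0 (\<lambda>n. i n \<omega>)) = (\<lambda>_. V 0 x0)"
    by blast
  then show ?case
    by (simp add: prob_space)
next
  case (Suc t)
  have "expectation (\<lambda>\<omega>. V (Suc t) (\<lambda>n. i n \<omega>))
      = expectation (\<lambda>\<omega>. \<Sum>j\<in>UNIV. p j * V (Suc t) ((\<lambda>n. i n \<omega>)(t := j)))"
    unfolding dist[symmetric, of _ t] by (rule expectation_next_sample[OF dep])
  also have "\<dots> \<le> expectation (\<lambda>\<omega>. c * V t (\<lambda>n. i n \<omega>))"
  proof (rule integral_mono)
    show "integrable M (\<lambda>\<omega>. \<Sum>j\<in>UNIV. p j * V (Suc t) ((\<lambda>n. i n \<omega>)(t := j)))"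
      by (rule integrable_prefix[where k = t
            and G = "\<lambda>x. \<Sum>j\<in>UNIV. p j * V (Suc t) (x(t := j))"])
         (auto intro!: sum.cong dep simp: less_Suc_eq)
    show "integrable M (\<lambda>\<omega>. c * V t (\<lambda>n. i n \<omega>))"
      by (intro integrable_mult_right integrable_prefix[of t]) (rule dep)
  qed (rule step)
  also have "\<dots> \<le> c * (c ^ t * V 0 x0)"
    using Suc.IH c by (simp add: mult_left_mono)
  finally show ?case
    by simp
qed

end

end

section \<open>Coordinate descent\<close>

text \<open>Strong induction, since the recursion reaches back two iterates.\<close>

lemma cd_iterate_prefix:
  "(\<forall>n<k. x n = y n) \<Longrightarrow> cd_iterate A b \<gamma> \<beta> w0 x k = cd_iterate A b \<gamma> \<beta> w0 y k"
proof (induction k rule: less_induct)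
  case (less k)
  show ?case
  proof (cases k)
    case (Suc n)
    then have "cd_iterate A b \<gamma> \<beta> w0 x n = cd_iterate A b \<gamma> \<beta> w0 y n"
      "cd_iterate A b \<gamma> \<beta> w0 x (n - 1) = cd_iterate A b \<gamma> \<beta> w0 y (n - 1)" "x n = y n"
      using less by auto
    then show ?thesis
      using Suc by simp
  qed simp
qed

lemma cd_iterate_update:
  "k \<le> n \<Longrightarrow> cd_iterate A b \<gamma> \<beta> w0 (x(n := j)) k = cd_iterate A b \<gamma> \<beta> w0 x k"
  by (rule cd_iterate_prefix) auto

section \<open>Expected residual bounds under the sampling law\<close>

context
  fixes A :: "real^'m^'m" and b w0 wstar :: "real^'m"
    and M :: "'a measure" and i :: "nat \<Rightarrow> 'a \<Rightarrow> 'm"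
  assumes spd: "sym_pos_def A"
    and sol: "A *v wstar = b"
    and prob: "prob_space M"
    and indep: "prob_space.indep_vars M (\<lambda>_. count_space UNIV) i UNIV"
    and dist: "\<And>k j. measure M {\<omega> \<in> space M. i k \<omega> = j} = A $ j $ j / trace A"
begin

interpretation prob_space M
  by (rule prob)

lemma cd_residual: "A *v w - b = A *v (w - wstar)"
  by (simp add: sol matrix_vector_mult_diff_distrib)

lemma cd_coordinate: "row j A \<bullet> w - b $ j = (A *v (w - wstar)) $ j"
  by (metis cd_residual matrix_vector_mul_component row_def vec_lambda_eta vector_minus_component)

lemma integrable_cd_iterate:
  "integrable M (\<lambda>\<omega>. f (cd_iterate A b \<gamma> \<beta> w0 (\<lambda>k. i k \<omega>) t) :: real)"
  by (rule integrable_prefix[OF indep, of t "\<lambda>x. f (cd_iterate A b \<gamma> \<beta> w0 x t)"])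
     (metis cd_iterate_prefix)

lemma cd_plain_bound:
  "expectation (\<lambda>\<omega>. (norm (A *v cd_iterate A b (\<lambda>_. 1) (\<lambda>_. 0) w0 (\<lambda>k. i k \<omega>) t - b))\<^sup>2)
    \<le> lambda_max A * ((1 - lambda_min A / trace A) ^ t * (energy_norm A (w0 - wstar))\<^sup>2)"
proof -
  let ?w = "\<lambda>x k. cd_iterate A b (\<lambda>_. 1) (\<lambda>_. 0) w0 x k"
  define q where "q z = z \<bullet> (A *v z)" for z
  define V where "V k x = q (?w x k - wstar)" for k and x :: "nat \<Rightarrow> 'm"
  have step: "(\<Sum>j\<in>UNIV. A $ j $ j / trace A * V (Suc k) (x(k := j)))
      \<le> (1 - lambda_min A / trace A) * V k x" for k x
  proof -
    define r where "r = ?w x k - wstar"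
    \<comment> \<open>The factor \<open>1 *\<close> exhibits the case \<open>s = 1\<close>,
      \<open>g = A *v r\<close>, \<open>z = r\<close> of
      \<open>expected_coordinate_step\<close>.\<close>
    have next_w: "?w (x(k := j)) (Suc k) - wstar
        = r - (1 * (A *v r) $ j / A $ j $ j) *\<^sub>R axis j 1" for j
      by (simp add: cd_iterate_update cd_coordinate r_def algebra_simps)
    have "(\<Sum>j\<in>UNIV. A $ j $ j / trace A * V (Suc k) (x(k := j)))
        = q r - (norm (A *v r))\<^sup>2 / trace A"
      unfolding V_def q_def next_w expected_coordinate_step[OF spd]
      by (simp add: power2_norm_eq_inner)
    also have "\<dots> \<le> q r - lambda_min A * q r / trace A"
      using spd_residual_lower[OF spd, of r] spd_trace_pos[OF spd]
      by (simp add: q_def divide_right_mono)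
    finally show ?thesis
      by (simp add: V_def r_def algebra_simps)
  qed
  have dep: "V k x = V k y" if "\<forall>n<k. x n = y n" for k x y
    using cd_iterate_prefix[OF that] by (simp add: V_def)
  have "expectation (\<lambda>\<omega>. V t (\<lambda>k. i k \<omega>))
      \<le> (1 - lambda_min A / trace A) ^ t * V 0 (\<lambda>_. undefined)"
    using spd_trace_pos[OF spd] spd_lambda_min_le_trace[OF spd]
    by (intro expectation_contraction[OF indep dep dist step]) auto
  then have bound: "expectation (\<lambda>\<omega>. V t (\<lambda>k. i k \<omega>))
      \<le> (1 - lambda_min A / trace A) ^ t * (energy_norm A (w0 - wstar))\<^sup>2"
    by (simp add: V_def q_def energy_norm_sq[OF spd])
  have "expectation (\<lambda>\<omega>. (norm (A *v ?w (\<lambda>k. i k \<omega>) t - b))\<^sup>2)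
      \<le> expectation (\<lambda>\<omega>. lambda_max A * V t (\<lambda>k. i k \<omega>))"
  proof (rule integral_mono)
    show "integrable M (\<lambda>\<omega>. (norm (A *v ?w (\<lambda>k. i k \<omega>) t - b))\<^sup>2)"
      by (rule integrable_cd_iterate)
    show "integrable M (\<lambda>\<omega>. lambda_max A * V t (\<lambda>k. i k \<omega>))"
      unfolding V_def by (rule integrable_cd_iterate)
  qed (simp add: V_def q_def cd_residual spd_residual_upper[OF spd])
  also have "\<dots> \<le> lambda_max A * ((1 - lambda_min A / trace A) ^ t * (energy_norm A (w0 - wstar))\<^sup>2)"
    using bound spd_lambda_max_pos[OF spd] by simp
  finally show ?thesis .
qed

lemma cd_momentum_bound:
  "(real t + 1) * expectation (\<lambda>\<omega>. (norm (A *v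
      cd_iterate A b (gamma_momentum (1/2)) (beta_momentum (1/2)) w0 (\<lambda>k. i k \<omega>) t - b))\<^sup>2)
    \<le> 4 * trace A * (energy_norm A (w0 - wstar))\<^sup>2"
proof -
  let ?w = "\<lambda>x k. cd_iterate A b (gamma_momentum (1/2)) (beta_momentum (1/2)) w0 x k"
  define q where "q z = z \<bullet> (A *v z)" for z
  define N where "N z = (norm (A *v z))\<^sup>2" for z
  define T where "T = trace A"
  have T: "T > 0"
    using spd_trace_pos[OF spd] by (simp add: T_def)
  \<comment> \<open>The averaged form of the method: \<open>z\<^sub>k = r\<^sub>k + k / 2 (r\<^sub>k - r\<^sub>k\<^sub>-\<^sub>1)\<close> moves by plain
    stochastic gradient steps of size \<open>\<eta> = 1 / 2\<close>.\<close>
  define z where "z x k = (?w x k - wstar) + (real k / 2) *\<^sub>R (?w x k - ?w x (k - 1))"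
    for x :: "nat \<Rightarrow> 'm" and k
  \<comment> \<open>In \<open>V (Suc k)\<close> the second term involves iterate \<open>k\<close>,
    which is fixed before sample \<open>k\<close> is drawn; only the energy of \<open>z\<close> has
    to be averaged.\<close>
  define V where "V k x = q (z x k) + real k / 4 * N (?w x (k - 1) - wstar) / T"
    for k and x :: "nat \<Rightarrow> 'm"
  have step: "(\<Sum>j\<in>UNIV. A $ j $ j / trace A * V (Suc k) (x(k := j))) \<le> 1 * V k x" for k x
  proof -
    define r r' where "r = ?w x k - wstar" and "r' = ?w x (k - 1) - wstar"
    define l where "l = real k / 2"
    have "l \<ge> 0"
      by (simp add: l_def)
    \<comment> \<open>For \<eta> = 1/2 the common denominator of both parameters is exactly this
      factor, which scales the increment of the iterate in the next \<open>z\<close>.\<close>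
    have coeff: "(real (Suc k) / 2 + 1) * gamma_momentum (1/2) k = 1/2"
      "(real (Suc k) / 2 + 1) * beta_momentum (1/2) k = l"
      by (simp_all add: gamma_momentum_def beta_momentum_def l_def field_simps)
    have zk: "z x k = r + l *\<^sub>R (r - r')"
      by (simp add: z_def r_def r'_def l_def)
    have next_z: "z (x(k := j)) (Suc k) = z x k - (1/2 * (A *v r) $ j / A $ j $ j) *\<^sub>R axis j 1" for j
    proof -
      have "?w (x(k := j)) (Suc k) - ?w x k = beta_momentum (1/2) k *\<^sub>R (r - r')
          - (gamma_momentum (1/2) k * ((A *v r) $ j / A $ j $ j)) *\<^sub>R axis j 1"
        by (simp add: cd_iterate_update cd_coordinate r_def r'_def algebra_simps)
      moreover have "z (x(k := j)) (Suc k)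
          = r + (real (Suc k) / 2 + 1) *\<^sub>R (?w (x(k := j)) (Suc k) - ?w x k)"
        by (simp add: z_def r_def cd_iterate_update scaleR_left_distrib del: cd_iterate.simps)
      ultimately have "z (x(k := j)) (Suc k)
          = r + (((real (Suc k) / 2 + 1) * beta_momentum (1/2) k) *\<^sub>R (r - r')
            - ((real (Suc k) / 2 + 1) * gamma_momentum (1/2) k * ((A *v r) $ j / A $ j $ j)) *\<^sub>R axis j 1)"
        by (simp only: scaleR_diff_right scaleR_scaleR mult.assoc)
      then show ?thesis
        unfolding coeff zk by simp
    qed
    have prob_sum: "(\<Sum>j\<in>UNIV. A $ j $ j / trace A) = 1"
      unfolding sum_divide_distrib[symmetric] using T by (simp add: T_def trace_def)
    have V_Suc: "V (Suc k) (x(k := j)) = q (z (x(k := j)) (Suc k)) + real (Suc k) / 4 * N r / T" for j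
      by (simp add: V_def r_def cd_iterate_update)
    have "(\<Sum>j\<in>UNIV. A $ j $ j / trace A * V (Suc k) (x(k := j)))
        = (\<Sum>j\<in>UNIV. A $ j $ j / trace A * q (z (x(k := j)) (Suc k)))
          + real (Suc k) / 4 * N r / T"
      unfolding V_Suc distrib_left sum.distrib sum_distrib_right[symmetric] prob_sum by simp
    also have "(\<Sum>j\<in>UNIV. A $ j $ j / trace A * q (z (x(k := j)) (Suc k)))
        = q (z x k) - ((A *v r) \<bullet> (A *v z x k) - N r / 4) / T"
      unfolding q_def next_z expected_coordinate_step[OF spd]
      by (simp add: N_def T_def power2_norm_eq_inner power_divide)
    \<comment> \<open>As \<open>l = k / 2\<close>, the new weight \<open>(k + 1) / 4\<close> equals
      \<open>l / 2 + 1 / 4\<close>.\<close>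
    also have "\<dots> + real (Suc k) / 4 * N r / T
        = q (z x k) - ((A *v r) \<bullet> (A *v z x k) - N r / 2 - l / 2 * N r) / T"
      using T by (simp add: l_def field_simps)
    \<comment> \<open>Expanding \<open>z x k\<close> leaves the cross term of the two residuals,
      bounded by the mean of \<open>N r\<close> and \<open>N r'\<close>. The remaining surplus
      \<open>N r / 2\<close> is nonnegative and is dropped.\<close>
    also have "\<dots> \<le> q (z x k) - (- (l / 2 * N r')) / T"
    proof -
      have az: "(A *v r) \<bullet> (A *v z x k) = N r + l * (N r - (A *v r) \<bullet> (A *v r'))"
        by (simp add: zk N_def power2_norm_eq_inner matrix_vector_right_distrib
            matrix_vector_mult_diff_distrib matrix_vector_mult_scaleR inner_simps)
      have "0 \<le> (A *v r - A *v r') \<bullet> (A *v r - A *v r')"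
        by simp
      also have "\<dots> = N r + N r' - 2 * ((A *v r) \<bullet> (A *v r'))"
        by (simp add: N_def power2_norm_eq_inner inner_simps inner_commute)
      finally have "l * (2 * ((A *v r) \<bullet> (A *v r'))) \<le> l * (N r + N r')"
        using \<open>l \<ge> 0\<close> by (intro mult_left_mono) auto
      moreover have "0 \<le> N r"
        by (simp add: N_def)
      ultimately have "- (l / 2 * N r') \<le> (A *v r) \<bullet> (A *v z x k) - N r / 2 - l / 2 * N r"
        unfolding az by (simp add: algebra_simps)
      then show ?thesis
        using T by (intro diff_left_mono divide_right_mono) auto
    qed
    also have "\<dots> = 1 * V k x"
      by (simp add: V_def r'_def l_def)
    finally show ?thesis .
  qed
  have dep: "V k x = V k y" if "\<forall>n<k. x n = y n" for k x y
  proof -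
    have "?w x k = ?w y k" "?w x (k - 1) = ?w y (k - 1)"
      using that by (auto intro!: cd_iterate_prefix)
    then show ?thesis
      by (simp add: V_def z_def)
  qed
  \<comment> \<open>The index is \<open>Suc t\<close> because \<open>V (Suc t)\<close> contains the
    residual of iterate \<open>t\<close> with weight \<open>(t + 1) / (4 T)\<close>. At index 0
    extrapolation and residual term vanish, leaving the initial energy.\<close>
  have "expectation (\<lambda>\<omega>. V (Suc t) (\<lambda>k. i k \<omega>)) \<le> 1 ^ Suc t * V 0 (\<lambda>_. undefined)"
    by (rule expectation_contraction[OF indep dep dist step]) auto
  then have bound: "expectation (\<lambda>\<omega>. V (Suc t) (\<lambda>k. i k \<omega>)) \<le> (energy_norm A (w0 - wstar))\<^sup>2"
    by (simp add: V_def z_def q_def energy_norm_sq[OF spd])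
  have "expectation (\<lambda>\<omega>. (real (Suc t) / (4 * T)) * (norm (A *v ?w (\<lambda>k. i k \<omega>) t - b))\<^sup>2)
      \<le> expectation (\<lambda>\<omega>. V (Suc t) (\<lambda>k. i k \<omega>))"
  proof (rule integral_mono)
    show "integrable M (\<lambda>\<omega>. (real (Suc t) / (4 * T)) * (norm (A *v ?w (\<lambda>k. i k \<omega>) t - b))\<^sup>2)"
      by (rule integrable_cd_iterate)
    show "integrable M (\<lambda>\<omega>. V (Suc t) (\<lambda>k. i k \<omega>))"
      by (rule integrable_prefix[OF indep, of "Suc t"]) (rule dep)
    show "(real (Suc t) / (4 * T)) * (norm (A *v ?w (\<lambda>k. i k \<omega>) t - b))\<^sup>2
        \<le> V (Suc t) (\<lambda>k. i k \<omega>)" for \<omega>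
      using spd_nonneg[OF spd] by (simp add: V_def q_def N_def cd_residual)
  qed
  with bound have "(real (Suc t) / (4 * T)) *
      expectation (\<lambda>\<omega>. (norm (A *v ?w (\<lambda>k. i k \<omega>) t - b))\<^sup>2) \<le> (energy_norm A (w0 - wstar))\<^sup>2"
    by simp
  then show ?thesis
    using T by (simp add: T_def[symmetric] field_simps)
qed

end

text \<open>The case \<open>t = 0\<close>, \<open>\<epsilon> = lambda_max A\<close> is excluded in
  the second part because strictness fails there when \<open>w0 - wstar\<close> is an eigenvector
  for \<open>lambda_max A\<close>: the quotient then equals \<open>lambda_max A\<close>.\<close>

theorem corollary7p2:
  fixes A :: "real^'m^'m" and b w0 wstar :: "real^'m"
    and M :: "'a measure" and i :: "nat \<Rightarrow> 'a \<Rightarrow> 'm" and \<epsilon> :: real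
  assumes "sym_pos_def A"
    and "A *v wstar = b"
    and "w0 \<noteq> wstar"
    and "prob_space M"
    and "prob_space.indep_vars M (\<lambda>_. count_space UNIV) i UNIV"
    and "\<And>k j. measure M {\<omega> \<in> space M. i k \<omega> = j} = A $ j $ j / trace A"
    and "\<epsilon> > 0"
  shows
    "(\<forall>t::nat. real t \<ge> 4 * (trace A / \<epsilon>) \<longrightarrow>
        (\<integral>\<omega>. (norm (A *v cd_iterate A b (gamma_momentum (1/2)) (beta_momentum (1/2)) w0 (\<lambda>k. i k \<omega>) t - b))\<^sup>2 \<partial>M)
          / (energy_norm A (w0 - wstar))\<^sup>2 < \<epsilon>)
     \<and>
     (\<forall>t::nat. real t \<ge> trace A / lambda_min A * ln (lambda_max A / \<epsilon>) \<longrightarrow>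
        \<not> (t = 0 \<and> \<epsilon> = lambda_max A) \<longrightarrow>
        (\<integral>\<omega>. (norm (A *v cd_iterate A b (\<lambda>_. 1) (\<lambda>_. 0) w0 (\<lambda>k. i k \<omega>) t - b))\<^sup>2 \<partial>M)
          / (energy_norm A (w0 - wstar))\<^sup>2 < \<epsilon>)"
proof -
  note spd = assms(1) and hyps = assms(1,2,4,5,6)
  define D where "D = (energy_norm A (w0 - wstar))\<^sup>2"
  have D: "D > 0"
    using spd_pos[OF spd, of "w0 - wstar"] assms(3) by (simp add: D_def energy_norm_sq[OF spd])
  have T: "trace A > 0" and lmin: "lambda_min A > 0" and lmax: "lambda_max A > 0"
    using spd_trace_pos spd_lambda_min_pos spd_lambda_max_pos spd by auto
  have mom: "E / D < \<epsilon>"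
    if t: "real t \<ge> 4 * (trace A / \<epsilon>)" and E: "(real t + 1) * E \<le> 4 * trace A * D" for t E
  proof -
    have "4 * trace A \<le> real t * \<epsilon>"
      using t \<open>\<epsilon> > 0\<close> by (simp add: field_simps)
    \<comment> \<open>The extra 1 in \<open>t + 1\<close> makes the inequality strict.\<close>
    then have "4 * trace A < (real t + 1) * \<epsilon>"
      using \<open>\<epsilon> > 0\<close> by (simp add: algebra_simps)
    then have "4 * trace A * D < (real t + 1) * \<epsilon> * D"
      using D by (rule mult_strict_right_mono)
    then have "(real t + 1) * E < (real t + 1) * (\<epsilon> * D)"
      unfolding mult.assoc[of "real t + 1"] by (rule le_less_trans[OF E])
    then have "E < \<epsilon> * D"
      by (rule mult_left_less_imp_less) simp
    then show ?thesis
      using D by (simp add: field_simps)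
  qed
  define \<rho> where "\<rho> = lambda_min A / trace A"
  have \<rho>: "0 < \<rho>" "\<rho> \<le> 1"
    using T lmin spd_lambda_min_le_trace[OF spd] by (auto simp: \<rho>_def)
  have plain: "E / D < \<epsilon>"
    if t: "real t \<ge> trace A / lambda_min A * ln (lambda_max A / \<epsilon>)"
      and ne: "\<not> (t = 0 \<and> \<epsilon> = lambda_max A)"
      and E: "E \<le> lambda_max A * ((1 - \<rho>) ^ t * D)" for t E
  proof -
    have "ln (lambda_max A / \<epsilon>) \<le> \<rho> * real t"
      using t T lmin by (simp add: \<rho>_def field_simps)
    then have "lambda_max A / \<epsilon> \<le> exp (\<rho> * real t)"
      using lmax \<open>\<epsilon> > 0\<close> by (metis divide_pos_pos exp_le_cancel_iff exp_ln)
    then have le: "lambda_max A * exp (- (\<rho> * real t)) \<le> \<epsilon>"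
      using \<open>\<epsilon> > 0\<close> by (simp add: exp_minus field_simps)
    \<comment> \<open>Strictness comes from \<open>1 - \<rho> < exp (- \<rho>)\<close> when
      \<open>t > 0\<close>, and from the excluded case \<open>ne\<close> when
      \<open>t = 0\<close>.\<close>
    have "lambda_max A * (1 - \<rho>) ^ t < \<epsilon>"
    proof (cases "t = 0")
      case True
      then show ?thesis
        using le ne by simp
    next
      case False
      have "1 - \<rho> < exp (- \<rho>)"
        using exp_minus_greater \<rho> by auto
      then have "(1 - \<rho>) ^ t < exp (- \<rho>) ^ t"
        using False \<rho> by (intro power_strict_mono) auto
      also have "\<dots> = exp (- (\<rho> * real t))"
        by (simp add: exp_of_nat_mult[symmetric] mult.commute)
      finally show ?thesis
        using le lmax by (smt (verit) mult_strict_left_mono)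
    qed
    then have "lambda_max A * (1 - \<rho>) ^ t * D < \<epsilon> * D"
      using D by (rule mult_strict_right_mono)
    with E have "E < \<epsilon> * D"
      by (simp add: mult.assoc)
    then show ?thesis
      using D by (simp add: field_simps)
  qed
  show ?thesis
    unfolding D_def[symmetric]
    using mom[OF _ cd_momentum_bound[OF hyps, of _ w0, folded D_def]]
      plain[OF _ _ cd_plain_bound[OF hyps, of w0, folded D_def \<rho>_def]]
    by blast
qed

end
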